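(* Let $L_f, M_f > 0$ be constants and let $f:\mathbb{R}^d\to\mathbb{R}$ be a twice differentiable function with $\inf_{x\in\mathbb{R}^d} f(x) > -\infty$ such that for all $x,y\in\mathbb{R}^d$: (a) $\|\nabla f(x)-\nabla f(y)\|\le L_f\|x-y\|$; (b) $\|\nabla^2 f(x)-\nabla^2 f(y)\|\le M_f\|x-y\|$. Run Algorithm A (defined in the context) with inputs $x_{\mathrm{init}}\in\mathbb{R}^d$, $L_{\mathrm{init}}, M_0>0$, $\alpha>1$, $0<\beta\le 1$, and with $M_k$ computed by rule (P) or by rule (T). Let $z_K$ denote $\bar y_k$ at the total iteration $K$ of the algorithm. Then $$\lim_{K\to\infty}\ \min_{1\le i\le K}\|\nabla f(z_i)\|=0.$$
   Context: $\|\cdot\|$ is the Euclidean norm for vectors and the operator norm for matrices. Algorithm A. Inputs: $x_{\mathrm{init}}\in\mathbb{R}^d$; $L_{\mathrm{init}},M_0>0$; $\alpha>1$; $0<\beta\le1$. Initialize $(x_0,y_0)\leftarrow(x_{\mathrm{init}},x_{\mathrm{init}})$, $L\leftarrow L_{\mathrm{init}}$, $k\leftarrow 0$, $K\leftarrow 0$. Then repeat (indefinitely): 1. $k\leftarrow k+1$, $K\leftarrow K+1$. 2. $x_k\leftarrow y_{k-1}-\frac1L\nabla f(y_{k-1})$ and $y_k\leftarrow x_k+\theta_k(x_k-x_{k-1})$, where $\theta_k:=\frac{k}{k+1}$. 3. With $S_k:=\sum_{i=1}^k\|x_i-x_{i-1}\|^2$: if $f(x_k)>f(x_0)-\frac{L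 S_k}{2(k+1)}$, restart: $(x_0,y_0)\leftarrow(x_{k-1},x_{k-1})$, $L\leftarrow\alpha L$, $k\leftarrow0$. 4. Otherwise, if $(k+1)^5M_k^2S_k>L^2$, restart: $(x_0,y_0)\leftarrow(x_k,x_k)$, $L\leftarrow\beta L$, $k\leftarrow0$. The period between one reset of $k$ to $0$ and the next is an epoch; $L$ is constant within an epoch. $K$ is the total iteration count and is never reset. In every epoch the sequence $(M_k)$ starts again from the input value $M_0$. Averaged solution (within an epoch, evaluated at iteration $k\ge1$ before any reset of $k$): $\bar y_k:=\frac{2}{k(k+1)}\sum_{i=0}^{k-1}(i+1)y_i$, and $Z_k:=\frac{k+1}{2}$. Rule (P): for $k\ge1$, $M_k$ is the maximum of $M_{k-1}$ and the two quantities $$\frac{12\left(f(y_k)-f(x_k)-\frac12\langle\nabla f(y_k)+\nabla f(x_k),y_k-x_k\rangle\right)}{\|y_k-x_k\|^3},\qquad \frac{\|\nabla f(y_k)+\theta_k\nabla f(x_{k-1})-(1+\theta_k)\nabla f(x_k)\|}{\theta_k\|x_k-x_{k-1}\|^2}.$$ Rule (T): $M_k$ is the maximum of $M_{k-1}$, the same two quantities, and $$\frac{16\left(Z_k^2\|\nabla f(\bar y_k)\|-Z_kL\|x_k-x_{k-1}\|\right)}{(k-1)(k+5)^2S_k}.$$ Any quantity of the form $0/0$ is omitted from the maximum. *)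

theory Defs
  imports "HOL-Analysis.Analysis"
begin

definition grad :: "('a::real_inner \<Rightarrow> real) \<Rightarrow> 'a \<Rightarrow> 'a" where
  "grad f x = (THE D. GDERIV f x :> D)"

definition hessian :: "(real ^ 'd \<Rightarrow> real) \<Rightarrow> real ^ 'd \<Rightarrow> real ^ 'd ^ 'd" where
  "hessian f x = jacobian (grad f) (at x)"

definition twice_differentiable :: "(real ^ 'd \<Rightarrow> real) \<Rightarrow> bool" where
  "twice_differentiable f \<longleftrightarrow>
     (\<forall>x. f differentiable (at x)) \<and> (\<forall>x. grad f differentiable (at x))"

(* Sequences of one epoch.  Within an epoch, everything is determined by the starting point
   x0 and the constant L, so x_k, y_k, S_k, M_k and the averaged solution are defined for all k as
   functions of (x0, L).  The algorithm only reads them up to the index k at which it restarts. *)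

definition theta :: "nat \<Rightarrow> real" where
  "theta k = real k / (real k + 1)"

primrec epoch_xy :: "(real ^ 'd \<Rightarrow> real) \<Rightarrow> real ^ 'd \<Rightarrow> real \<Rightarrow> nat
    \<Rightarrow> (real ^ 'd) \<times> (real ^ 'd)" where
  "epoch_xy f x0 L 0 = (x0, x0)"
| "epoch_xy f x0 L (Suc k) =
     (let (x, y) = epoch_xy f x0 L k;
          x' = y - (1 / L) *\<^sub>R grad f y;
          y' = x' + theta (Suc k) *\<^sub>R (x' - x)
      in (x', y'))"

definition epoch_x :: "(real ^ 'd \<Rightarrow> real) \<Rightarrow> real ^ 'd \<Rightarrow> real \<Rightarrow> nat \<Rightarrow> real ^ 'd" where
  "epoch_x f x0 L k = fst (epoch_xy f x0 L k)"

definition epoch_y :: "(real ^ 'd \<Rightarrow> real) \<Rightarrow> real ^ 'd \<Rightarrow> real \<Rightarrow> nat \<Rightarrow> real ^ 'd" where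
  "epoch_y f x0 L k = snd (epoch_xy f x0 L k)"

definition epoch_S :: "(real ^ 'd \<Rightarrow> real) \<Rightarrow> real ^ 'd \<Rightarrow> real \<Rightarrow> nat \<Rightarrow> real" where
  "epoch_S f x0 L k = (\<Sum>i=1..k. (norm (epoch_x f x0 L i - epoch_x f x0 L (i - 1)))\<^sup>2)"

definition averaged_y :: "(real ^ 'd \<Rightarrow> real) \<Rightarrow> real ^ 'd \<Rightarrow> real \<Rightarrow> nat \<Rightarrow> real ^ 'd" where
  "averaged_y f x0 L k =
     (2 / (real k * (real k + 1))) *\<^sub>R (\<Sum>i<k. (real i + 1) *\<^sub>R epoch_y f x0 L i)"

definition Z :: "nat \<Rightarrow> real" where
  "Z k = (real k + 1) / 2"

datatype M_rule = Rule_P | Rule_T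

(* Each quotient is kept as a pair (numerator, denominator), so that the quotients of
   the form 0/0 can be omitted from the maximum. *)

definition quotients_P :: "(real ^ 'd \<Rightarrow> real) \<Rightarrow> real ^ 'd \<Rightarrow> real \<Rightarrow> nat
    \<Rightarrow> (real \<times> real) set" where
  "quotients_P f x0 L k =
     (let x = epoch_x f x0 L k; xp = epoch_x f x0 L (k - 1); y = epoch_y f x0 L k in
      {(12 * (f y - f x - 1 / 2 * inner (grad f y + grad f x) (y - x)),
        norm (y - x) ^ 3),
       (norm (grad f y + theta k *\<^sub>R grad f xp - (1 + theta k) *\<^sub>R grad f x),
        theta k * (norm (x - xp))\<^sup>2)})"

definition quotients_T :: "(real ^ 'd \<Rightarrow> real) \<Rightarrow> real ^ 'd \<Rightarrow> real \<Rightarrow> nat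
    \<Rightarrow> (real \<times> real) set" where
  "quotients_T f x0 L k = insert
     (16 * ((Z k)\<^sup>2 * norm (grad f (averaged_y f x0 L k))
            - Z k * L * norm (epoch_x f x0 L k - epoch_x f x0 L (k - 1))),
      (real k - 1) * (real k + 5)\<^sup>2 * epoch_S f x0 L k)
     (quotients_P f x0 L k)"

fun quotients :: "M_rule \<Rightarrow> (real ^ 'd \<Rightarrow> real) \<Rightarrow> real ^ 'd \<Rightarrow> real \<Rightarrow> nat
    \<Rightarrow> (real \<times> real) set" where
  "quotients Rule_P = quotients_P"
| "quotients Rule_T = quotients_T"

definition max_quotients :: "real \<Rightarrow> (real \<times> real) set \<Rightarrow> real" where
  "max_quotients m Q = Max (insert m {p / q | p q. (p, q) \<in> Q \<and> \<not> (p = 0 \<and> q = 0)})"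

primrec epoch_M :: "M_rule \<Rightarrow> (real ^ 'd \<Rightarrow> real) \<Rightarrow> real \<Rightarrow> real ^ 'd \<Rightarrow> real \<Rightarrow> nat
    \<Rightarrow> real" where
  "epoch_M r f M0 x0 L 0 = M0"
| "epoch_M r f M0 x0 L (Suc k) =
     max_quotients (epoch_M r f M0 x0 L k) (quotients r f x0 L (Suc k))"

(* State between two iterations: starting point x_0 of the current epoch, its constant L, and
   the counter k. *)

record ('d::finite) alg_state =
  start :: "real ^ 'd"
  stepL :: real
  counter :: nat

definition alg_step :: "M_rule \<Rightarrow> (real ^ 'd \<Rightarrow> real) \<Rightarrow> real \<Rightarrow> real \<Rightarrow> real
    \<Rightarrow> 'd alg_state \<Rightarrow> 'd alg_state" where
  "alg_step r f M0 \<alpha> \<beta> s =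
     (let x0 = start s; L = stepL s; k = counter s + 1; S = epoch_S f x0 L k in
      if f (epoch_x f x0 L k) > f x0 - L * S / (2 * (real k + 1))
      then \<lparr>start = epoch_x f x0 L (k - 1), stepL = \<alpha> * L, counter = 0\<rparr>
      else if (real k + 1) ^ 5 * (epoch_M r f M0 x0 L k)\<^sup>2 * S > L\<^sup>2
      then \<lparr>start = epoch_x f x0 L k, stepL = \<beta> * L, counter = 0\<rparr>
      else \<lparr>start = x0, stepL = L, counter = k\<rparr>)"

primrec alg_run :: "M_rule \<Rightarrow> (real ^ 'd \<Rightarrow> real) \<Rightarrow> real ^ 'd \<Rightarrow> real \<Rightarrow> real \<Rightarrow> real \<Rightarrow> real
    \<Rightarrow> nat \<Rightarrow> 'd alg_state" where
  "alg_run r f x_init L_init M0 \<alpha> \<beta> 0 = \<lparr>start = x_init, stepL = L_init, counter = 0\<rparr>"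
| "alg_run r f x_init L_init M0 \<alpha> \<beta> (Suc K) =
     alg_step r f M0 \<alpha> \<beta> (alg_run r f x_init L_init M0 \<alpha> \<beta> K)"

(* The averaged solution at total iteration K \<ge> 1.  It is evaluated before any reset of k in
   iteration K, hence with the epoch data left by iteration K - 1 and the incremented counter. *)

definition alg_z :: "M_rule \<Rightarrow> (real ^ 'd \<Rightarrow> real) \<Rightarrow> real ^ 'd \<Rightarrow> real \<Rightarrow> real \<Rightarrow> real \<Rightarrow> real
    \<Rightarrow> nat \<Rightarrow> real ^ 'd" where
  "alg_z r f x_init L_init M0 \<alpha> \<beta> K =
     (let s = alg_run r f x_init L_init M0 \<alpha> \<beta> (K - 1)
      in averaged_y f (start s) (stepL s) (counter s + 1))"

end

(* Suppose all averaged gradients have norm at least epsilon.  Only M_k >= M_0 matters about the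
   estimates M_k: an iteration that survives the test of step 4 has S_k <= L^2 / (M_0^2 (k+1)^5),
   so ||grad f(ybar_k)|| = O(L^2 k^(-7/2) + L k^(-3/2)), which bounds k by O(L^(2/3)) for large L.
   On the other hand an energy argument using only the Lipschitz gradient shows that step 3 cannot
   trigger while k <= L / (8 L_f) - 2.  Hence step 3 never triggers once L is large, and both L and
   k stay bounded.  A step 4 restart then decreases the bounded below value f(x_0) by a fixed
   amount, since S_k >= S_1 >= epsilon^2 / L^2, and so happens only finitely often; afterwards L
   only grows by factors alpha, so there are finitely many epochs, contradicting the bound on k. *)

theory Submission
  imports Defs
begin

section \<open>Gradients\<close>

text \<open>\<open>grad\<close> is a definite description, so existence and uniqueness are both due.
  The witness is the Riesz vector of the derivative, its adjoint at 1.\<close>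

lemma GDERIV_grad:
  fixes f :: "'a::euclidean_space \<Rightarrow> real"
  assumes "f differentiable (at x)"
  shows "GDERIV f x :> grad f x"
proof -
  obtain f' where f': "(f has_derivative f') (at x)"
    using assms by (auto simp: differentiable_def)
  then interpret bounded_linear f' by (rule has_derivative_bounded_linear)
  have "f' = (\<lambda>h. inner h (adjoint f' 1))"
    using adjoint_works[OF linear_axioms, of _ 1] by auto
  with f' have "GDERIV f x :> adjoint f' 1"
    unfolding gderiv_def by (rule has_derivative_eq_rhs)
  moreover have "D = D'" if "GDERIV f x :> D" "GDERIV f x :> D'" for D D'
    using has_derivative_unique[OF that[unfolded gderiv_def]]
    by (metis inner_commute vector_eq_ldot)
  ultimately show ?thesis
    unfolding grad_def by (metis theI)
qed

lemma grad_mean_value: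
  fixes f :: "'a::euclidean_space \<Rightarrow> real"
  assumes diff: "\<And>x. f differentiable (at x)"
  obtains t where "0 < t" "t < 1" "f b - f a = inner (grad f (a + t *\<^sub>R (b - a))) (b - a)"
proof -
  define p where "p t = a + t *\<^sub>R (b - a)" for t :: real
  have p: "(p has_derivative (\<lambda>s. s *\<^sub>R (b - a))) (at t)" for t
    unfolding p_def by (auto intro!: derivative_eq_intros)
  have "((\<lambda>t. f (p t)) has_derivative (\<lambda>s. inner (s *\<^sub>R (b - a)) (grad f (p t)))) (at t)" for t
    using has_derivative_compose[OF p GDERIV_grad[OF diff, unfolded gderiv_def]] by simp
  then have "((\<lambda>t. f (p t)) has_real_derivative inner (grad f (p t)) (b - a)) (at t)" for t
    unfolding has_field_derivative_def
    by (rule has_derivative_eq_rhs) (auto simp: inner_commute mult.commute)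
  from MVT2[of 0 1 "\<lambda>t. f (p t)", OF _ this] show ?thesis
    using that by (auto simp: p_def)
qed

section \<open>One epoch\<close>

lemma epoch_x_0 [simp]: "epoch_x f x0 L 0 = x0"
  by (simp add: epoch_x_def)

text \<open>This includes k = 0, where \<open>k - 1\<close> is 0 and the displacement
  vanishes.\<close>

lemma epoch_y_eq:
  "epoch_y f x0 L k = epoch_x f x0 L k + theta k *\<^sub>R (epoch_x f x0 L k - epoch_x f x0 L (k - 1))"
  by (cases k) (simp_all add: epoch_x_def epoch_y_def Let_def split_def)

lemma epoch_x_Suc:
  "epoch_x f x0 L (Suc k) = epoch_y f x0 L k - (1 / L) *\<^sub>R grad f (epoch_y f x0 L k)"
  by (simp add: epoch_x_def epoch_y_def Let_def split_def)

lemma epoch_y_0 [simp]: "epoch_y f x0 L 0 = x0"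
  by (simp add: epoch_y_def)

lemma averaged_y_1 [simp]: "averaged_y f x0 L (Suc 0) = x0"
  by (simp add: averaged_y_def)

lemma epoch_S_0 [simp]: "epoch_S f x0 L 0 = 0"
  by (simp add: epoch_S_def)

lemma epoch_S_Suc:
  "epoch_S f x0 L (Suc k) =
     epoch_S f x0 L k + (norm (epoch_x f x0 L (Suc k) - epoch_x f x0 L k))\<^sup>2"
  by (simp add: epoch_S_def)

lemma epoch_S_nonneg: "0 \<le> epoch_S f x0 L k"
  by (simp add: epoch_S_def sum_nonneg)

lemma epoch_S_mono: "j \<le> k \<Longrightarrow> epoch_S f x0 L j \<le> epoch_S f x0 L k"
  unfolding epoch_S_def by (rule sum_mono2) auto

lemma norm_step_le:
  assumes "j \<le> k"
  shows "norm (epoch_x f x0 L j - epoch_x f x0 L (j - 1)) \<le> sqrt (epoch_S f x0 L k)"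
proof (cases j)
  case (Suc i)
  have "(norm (epoch_x f x0 L j - epoch_x f x0 L (j - 1)))\<^sup>2 \<le> epoch_S f x0 L j"
    using epoch_S_nonneg[of f x0 L i] by (simp add: Suc epoch_S_Suc)
  also have "\<dots> \<le> epoch_S f x0 L k"
    using assms by (rule epoch_S_mono)
  finally show ?thesis by (rule real_le_rsqrt)
qed (simp add: epoch_S_nonneg)

text \<open>As y_0 = x_0, an epoch opens with a plain gradient step, and S only grows
  afterwards.\<close>

lemma epoch_S_ge:
  assumes "L > 0" "k \<ge> 1"
  shows "(norm (grad f x0))\<^sup>2 / L\<^sup>2 \<le> epoch_S f x0 L k"
  using epoch_S_mono[of 1 k f x0 L] assms
  by (simp add: epoch_S_Suc epoch_x_Suc power_divide)

lemma max_quotients_ge: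
  assumes "finite Q"
  shows "m \<le> max_quotients m Q"
proof -
  have "{p / q | p q. (p, q) \<in> Q \<and> \<not> (p = 0 \<and> q = 0)} \<subseteq> (\<lambda>(p, q). p / q) ` Q"
    by force
  then have "finite {p / q | p q. (p, q) \<in> Q \<and> \<not> (p = 0 \<and> q = 0)}"
    using assms finite_surj by blast
  then show ?thesis
    unfolding max_quotients_def by (intro Max_ge) auto
qed

lemma finite_quotients: "finite (quotients r f x0 L k)"
  by (cases r) (simp_all add: quotients_T_def quotients_P_def Let_def)

lemma epoch_M_ge: "M0 \<le> epoch_M r f M0 x0 L k"
  by (induction k) (auto intro: order_trans[OF _ max_quotients_ge[OF finite_quotients]])

text \<open>With u = 1/(i + 1), the square is 1 - 2u + u^2, and i >= 1 gives u <= 1/2.\<close>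

lemma theta_sq_le:
  assumes "1 \<le> i" "i \<le> n"
  shows "(theta i)\<^sup>2 \<le> 1 - 3 / (2 * (real n + 1))"
proof -
  define u where "u = 1 / (real i + 1)"
  have u: "0 \<le> u" "u \<le> 1 / 2" "theta i = 1 - u"
    using assms(1) by (simp_all add: u_def theta_def field_simps)
  have "u * u \<le> 1 / 2 * u"
    using u by (intro mult_right_mono) auto
  then have "(theta i)\<^sup>2 \<le> 1 - 3 / 2 * u"
    by (simp add: u(3) power2_eq_square algebra_simps)
  also have "\<dots> = 1 - 3 / (2 * (real i + 1))"
    by (simp add: u_def)
  also have "\<dots> \<le> 1 - 3 / (2 * (real n + 1))"
    using assms by (simp add: frac_le)
  finally show ?thesis .
qed

lemma theta_bounds: "0 \<le> theta k" "theta k \<le> 1"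
  by (simp_all add: theta_def)

section \<open>Descent of the iterates under a Lipschitz gradient\<close>

locale smooth_objective =
  fixes f :: "real ^ 'd \<Rightarrow> real" and Lf :: real
  assumes diff: "\<And>x. f differentiable (at x)"
    and Lf_pos: "Lf > 0"
    and lipschitz: "\<And>x y. norm (grad f x - grad f y) \<le> Lf * norm (x - y)"
begin

text \<open>The third point y stands for the extrapolated point, where the algorithm evaluates the
  gradient. The mean value point lies between a and b, hence within |b - a| + |y - a| of y.\<close>

lemma increment_le:
  "f b - f a \<le> inner (grad f y) (b - a) + Lf * (norm (b - a) + norm (y - a)) * norm (b - a)"
proof -
  obtain t where t: "0 < t" "t < 1" "f b - f a = inner (grad f (a + t *\<^sub>R (b - a))) (b - a)"
    using grad_mean_value[OF diff] .
  let ?c = "a + t *\<^sub>R (b - a)"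
  have "norm (?c - y) \<le> norm (t *\<^sub>R (b - a)) + norm (a - y)"
    using norm_triangle_ineq[of "t *\<^sub>R (b - a)" "a - y"] by (simp add: algebra_simps)
  also have "\<dots> \<le> norm (b - a) + norm (y - a)"
    using t by (simp add: norm_minus_commute mult_left_le_one_le)
  finally have c: "norm (?c - y) \<le> norm (b - a) + norm (y - a)" .
  have "inner (grad f ?c - grad f y) (b - a) \<le> norm (grad f ?c - grad f y) * norm (b - a)"
    by (rule norm_cauchy_schwarz)
  also have "\<dots> \<le> Lf * (norm (b - a) + norm (y - a)) * norm (b - a)"
    using c Lf_pos order_trans[OF lipschitz mult_left_mono[OF c, of Lf]] by (intro mult_right_mono) auto
  finally show ?thesis
    using t by (simp add: inner_diff_left)
qed

text \<open>With u the momentum shift to y_k and v the new displacement, the gradient at y_k is L (u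
  - v). Young's inequality separates u from v, both in the inner product and in the Lipschitz
  error.\<close>

lemma energy_step:
  fixes x0 L k
  defines "d \<equiv> \<lambda>k. epoch_x f x0 L k - epoch_x f x0 L (k - 1)"
  assumes "L > 0"
  shows "f (epoch_x f x0 L (Suc k)) + (L / 2 - 3 / 2 * Lf) * (norm (d (Suc k)))\<^sup>2
    \<le> f (epoch_x f x0 L k) + (L + Lf) / 2 * (theta k)\<^sup>2 * (norm (d k))\<^sup>2"
proof -
  let ?x = "epoch_x f x0 L" and ?y = "epoch_y f x0 L"
  define u where "u = theta k *\<^sub>R d k"
  define v where "v = d (Suc k)"
  have y: "?y k - ?x k = u"
    by (simp add: u_def d_def epoch_y_eq)
  have v: "?x (Suc k) - ?x k = v"
    by (simp add: v_def d_def)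
  have "grad f (?y k) = L *\<^sub>R (?y k - ?x (Suc k))"
    using assms(2) by (simp add: epoch_x_Suc)
  also have "?y k - ?x (Suc k) = u - v"
    using y v by (simp add: algebra_simps flip: y v)
  finally have g: "inner (grad f (?y k)) v = L * (inner u v - (norm v)\<^sup>2)"
    by (simp add: inner_diff_left power2_norm_eq_inner)
  have uv: "norm u * norm v \<le> ((norm u)\<^sup>2 + (norm v)\<^sup>2) / 2"
    using sum_squares_bound[of "norm u" "norm v"] by simp
  have "inner u v \<le> ((norm u)\<^sup>2 + (norm v)\<^sup>2) / 2"
    using norm_cauchy_schwarz[of u v] uv by linarith
  then have "L * (inner u v - (norm v)\<^sup>2) \<le> L * (((norm u)\<^sup>2 + (norm v)\<^sup>2) / 2 - (norm v)\<^sup>2)"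
    using assms(2) by simp
  moreover have "Lf * (norm u * norm v) \<le> Lf * (((norm u)\<^sup>2 + (norm v)\<^sup>2) / 2)"
    using uv Lf_pos by simp
  moreover have "f (?x (Suc k)) - f (?x k)
      \<le> L * (inner u v - (norm v)\<^sup>2) + Lf * (norm v + norm u) * norm v"
    using increment_le[of "?x (Suc k)" "?x k" "?y k"] by (simp add: y v g)
  ultimately have "f (?x (Suc k)) + (L / 2 - 3 / 2 * Lf) * (norm v)\<^sup>2
      \<le> f (?x k) + (L + Lf) / 2 * (norm u)\<^sup>2"
    by (simp add: field_simps power2_eq_square)
  then show ?thesis
    by (simp add: u_def v_def power_mult_distrib mult.assoc)
qed

text \<open>The damping \<open>1 - \<theta>\<^sub>k\<^sup>2\<close>, of order \<open>1/k\<close>, beats the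
  curvature error \<open>L\<^sub>f / L\<close> per step as long as \<open>k\<close> is small compared to
  \<open>L / L\<^sub>f\<close>.\<close>

lemma sufficient_descent:
  assumes L: "8 * Lf * (real n + 1) \<le> L"
  shows "f (epoch_x f x0 L n) \<le> f x0 - L * epoch_S f x0 L n / (2 * (real n + 1))"
proof -
  let ?x = "epoch_x f x0 L"
  have "0 < 8 * Lf * (real n + 1)"
    using Lf_pos by simp
  then have L_pos: "L > 0"
    using L by linarith
  define m where "m = real n + 1"
  have m: "m > 0" "8 * Lf * m \<le> L"
    using L by (simp_all add: m_def)
  \<comment> \<open>The coefficient of S in the test of step 3 at index n, kept fixed for all k <=
    n. The invariant below carries the momentum term that \<open>energy_step\<close> charges to the
    next step.\<close>
  define a where "a = L / (2 * m)"
  have "f (?x k) + (L + Lf) / 2 * (theta k)\<^sup>2 * (norm (?x k - ?x (k - 1)))\<^sup>2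
      + a * epoch_S f x0 L k \<le> f x0" if "k \<le> n" for k
    using that
  proof (induction k)
    case (Suc k)
    let ?\<theta> = "theta (Suc k)" and ?D = "(norm (?x (Suc k) - ?x k))\<^sup>2"
    have th: "?\<theta>\<^sup>2 \<le> 1 - 3 / (2 * m)"
      unfolding m_def using Suc.prems by (intro theta_sq_le) auto
    \<comment> \<open>Damping saves 3L/(4m): of this, a = 2L/(4m) pays for the growth of S, and
      L/(4m) >= 2 Lf pays for curvature, 3/2 Lf from the new step and Lf/2 from the momentum
      term.\<close>
    have "L / 2 * ?\<theta>\<^sup>2 \<le> L / 2 * (1 - 3 / (2 * m))"
      using L_pos th by (intro mult_left_mono) auto
    also have "\<dots> = L / 2 - a - L / (4 * m)"
      using m by (simp add: a_def field_simps)
    also have "\<dots> \<le> L / 2 - a - 2 * Lf"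
      using m by (simp add: field_simps)
    finally have "L / 2 * ?\<theta>\<^sup>2 \<le> L / 2 - a - 2 * Lf" .
    moreover have "Lf / 2 * ?\<theta>\<^sup>2 \<le> Lf / 2"
      using Lf_pos theta_bounds[of "Suc k"] by (simp add: power_le_one)
    ultimately have "(L + Lf) / 2 * ?\<theta>\<^sup>2 + a \<le> L / 2 - 3 / 2 * Lf"
      by (simp add: field_simps)
    then have "((L + Lf) / 2 * ?\<theta>\<^sup>2 + a) * ?D \<le> (L / 2 - 3 / 2 * Lf) * ?D"
      by (rule mult_right_mono) simp
    moreover have "f (?x (Suc k)) + (L / 2 - 3 / 2 * Lf) * ?D
        \<le> f (?x k) + (L + Lf) / 2 * (theta k)\<^sup>2 * (norm (?x k - ?x (k - 1)))\<^sup>2"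
      using energy_step[OF L_pos, of x0 k] by simp
    moreover have "f (?x k) + (L + Lf) / 2 * (theta k)\<^sup>2 * (norm (?x k - ?x (k - 1)))\<^sup>2
        + a * epoch_S f x0 L k \<le> f x0"
      using Suc by simp
    ultimately show ?case
      unfolding epoch_S_Suc diff_Suc_1 distrib_left distrib_right by linarith
  qed simp
  from this[of n] have "f (?x n) + a * epoch_S f x0 L n \<le> f x0"
    using L_pos Lf_pos by (smt (verit) mult_nonneg_nonneg divide_nonneg_nonneg zero_le_power2 order_refl)
  then show ?thesis
    by (simp add: a_def m_def)
qed

section \<open>The gradient at the averaged point\<close>

lemma norm_epoch_y_le:
  assumes "j < k"
  shows "norm (epoch_y f x0 L j - x0) \<le> real k * sqrt (epoch_S f x0 L k)"
proof -
  let ?x = "epoch_x f x0 L" and ?s = "sqrt (epoch_S f x0 L k)"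
  have *: "norm (?x i - x0) \<le> real i * ?s" if "i \<le> k" for i
    using that
  proof (induction i)
    case (Suc i)
    have "norm (?x (Suc i) - x0) \<le> norm (?x (Suc i) - ?x i) + norm (?x i - x0)"
      using norm_triangle_ineq[of "?x (Suc i) - ?x i" "?x i - x0"] by simp
    then show ?case
      using Suc norm_step_le[of "Suc i" k f x0 L] by (simp add: algebra_simps)
  qed simp
  have "norm (epoch_y f x0 L j - x0) \<le> norm (?x j - x0) + norm (theta j *\<^sub>R (?x j - ?x (j - 1)))"
    using norm_triangle_ineq[of "?x j - x0" "theta j *\<^sub>R (?x j - ?x (j - 1))"]
    by (simp add: epoch_y_eq algebra_simps)
  also have "\<dots> \<le> real j * ?s + 1 * ?s"
    unfolding norm_scaleR
    using assms theta_bounds[of j] *[of j] norm_step_le[of j k f x0 L]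
    by (intro add_mono mult_mono) auto
  also have "\<dots> = real (Suc j) * ?s"
    by (simp add: algebra_simps)
  also have "\<dots> \<le> real k * ?s"
    using assms epoch_S_nonneg[of f x0 L k] by (intro mult_right_mono) auto
  finally show ?thesis .
qed

text \<open>The weights satisfy (k + 1) theta_k = k, so each momentum term cancels the displacement
  left by the preceding sum.\<close>

lemma weighted_gradients_telescope:
  assumes "L \<noteq> 0"
  shows "(\<Sum>i<k. (real i + 1) *\<^sub>R grad f (epoch_y f x0 L i)) =
    - (L * real k) *\<^sub>R (epoch_x f x0 L k - epoch_x f x0 L (k - 1))"
proof (induction k)
  case (Suc k)
  let ?x = "epoch_x f x0 L" and ?y = "epoch_y f x0 L"
  have "grad f (?y k) = L *\<^sub>R (?y k - ?x (Suc k))"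
    using assms by (simp add: epoch_x_Suc)
  then have "(real k + 1) *\<^sub>R grad f (?y k) = (L * (real k + 1)) *\<^sub>R (?y k - ?x (Suc k))"
    by (simp add: mult.commute)
  also have "\<dots> = (L * real k) *\<^sub>R (?x k - ?x (k - 1)) - (L * (real k + 1)) *\<^sub>R (?x (Suc k) - ?x k)"
  proof -
    have "(L * (real k + 1)) * theta k = L * real k"
      by (simp add: theta_def)
    then have "(L * (real k + 1)) *\<^sub>R theta k *\<^sub>R (?x k - ?x (k - 1)) = (L * real k) *\<^sub>R (?x k - ?x (k - 1))"
      by simp
    moreover have "?y k - ?x (Suc k) = theta k *\<^sub>R (?x k - ?x (k - 1)) - (?x (Suc k) - ?x k)"
      by (simp add: epoch_y_eq)
    ultimately show ?thesis
      by (simp only: scaleR_diff_right[of "L * (real k + 1)"])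
  qed
  finally have "(\<Sum>i<Suc k. (real i + 1) *\<^sub>R grad f (?y i)) =
      - (L * (real k + 1)) *\<^sub>R (?x (Suc k) - ?x k)"
    unfolding sum.lessThan_Suc Suc.IH by simp
  then show ?case
    by (simp add: add.commute)
qed simp

text \<open>The first term is the mean of the gradients, by telescoping. The second is the cost of
  passing to the gradient at the mean: the average and each y_i lie within k sqrt(S_k) of
  x_0.\<close>

lemma norm_grad_averaged_le:
  assumes "L > 0" "k \<ge> 1"
  shows "norm (grad f (averaged_y f x0 L k))
    \<le> (2 * L / (real k + 1) + 2 * Lf * real k) * sqrt (epoch_S f x0 L k)"
proof -
  let ?s = "sqrt (epoch_S f x0 L k)" and ?y = "epoch_y f x0 L"
  let ?g = "grad f (averaged_y f x0 L k)"
  define w where "w i = 2 / (real k * (real k + 1)) * (real i + 1)" for i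
  have w_nonneg: "0 \<le> w i" for i
    by (simp add: w_def)
  have sum_Suc: "(\<Sum>i<n. real i + 1) = real n * (real n + 1) / 2" for n
    by (induction n) (auto simp: field_simps)
  have w_sum: "(\<Sum>i<k. w i) = 1"
    unfolding w_def sum_distrib_left[symmetric] sum_Suc using assms by simp
  have avg: "averaged_y f x0 L k = (\<Sum>i<k. w i *\<^sub>R ?y i)"
    by (simp add: averaged_y_def w_def scaleR_sum_right)
  have "averaged_y f x0 L k - x0 = (\<Sum>i<k. w i *\<^sub>R (?y i - x0))"
    by (simp add: avg scaleR_diff_right sum_subtractf w_sum flip: scaleR_left.sum)
  also have "norm \<dots> \<le> (\<Sum>i<k. w i * (real k * ?s))"
    using norm_epoch_y_le w_nonneg by (intro sum_norm_le) (auto intro!: mult_left_mono)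
  also have "\<dots> = real k * ?s"
    by (simp add: w_sum flip: sum_distrib_right)
  finally have avg_le: "norm (averaged_y f x0 L k - x0) \<le> real k * ?s" .
  have dist: "norm (averaged_y f x0 L k - ?y i) \<le> 2 * real k * ?s" if "i < k" for i
    using norm_triangle_ineq4[of "averaged_y f x0 L k - x0" "?y i - x0"]
      avg_le norm_epoch_y_le[OF that, of x0 L] by simp
  have "?g - (\<Sum>i<k. w i *\<^sub>R grad f (?y i)) = (\<Sum>i<k. w i *\<^sub>R (?g - grad f (?y i)))"
    by (simp add: scaleR_diff_right sum_subtractf w_sum flip: scaleR_left.sum)
  also have "norm \<dots> \<le> (\<Sum>i<k. w i * (Lf * (2 * real k * ?s)))"
    using w_nonneg Lf_pos dist
    by (intro sum_norm_le) (auto intro!: mult_left_mono order_trans[OF lipschitz])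
  also have "\<dots> = Lf * (2 * real k * ?s)"
    by (simp add: w_sum flip: sum_distrib_right)
  finally have 1: "norm (?g - (\<Sum>i<k. w i *\<^sub>R grad f (?y i))) \<le> Lf * (2 * real k * ?s)" .
  have "(\<Sum>i<k. w i *\<^sub>R grad f (?y i)) =
      (2 / (real k * (real k + 1))) *\<^sub>R (\<Sum>i<k. (real i + 1) *\<^sub>R grad f (?y i))"
    by (simp add: w_def scaleR_sum_right)
  also have "\<dots> = - (2 * L / (real k + 1)) *\<^sub>R (epoch_x f x0 L k - epoch_x f x0 L (k - 1))"
    using assms by (simp add: weighted_gradients_telescope)
  also have "norm \<dots> \<le> 2 * L / (real k + 1) * ?s"
    unfolding norm_scaleR using assms norm_step_le[of k k f x0 L]
    by (intro mult_mono) auto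
  finally show ?thesis
    using 1 norm_triangle_ineq[of "?g - (\<Sum>i<k. w i *\<^sub>R grad f (?y i))" "\<Sum>i<k. w i *\<^sub>R grad f (?y i)"]
    by (simp add: algebra_simps)
qed

end

section \<open>The restarted algorithm\<close>

text \<open>A context to be refuted. \<open>Suc K\<close> occurs because iterations are counted from
  1.\<close>

locale run_with_large_gradients = smooth_objective f Lf
  for f :: "real ^ 'd \<Rightarrow> real" and Lf :: real +
  fixes r :: M_rule and x_init :: "real ^ 'd" and L_init M0 \<alpha> \<beta> \<epsilon> :: real
  assumes bdd: "bdd_below (range f)"
    and L_init_pos: "L_init > 0" and M0_pos: "M0 > 0"
    and alpha_gt_1: "\<alpha> > 1" and beta_pos: "0 < \<beta>" and beta_le_1: "\<beta> \<le> 1"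
    and eps_pos: "\<epsilon> > 0"
    and eps_le: "\<And>K. \<epsilon> \<le> norm (grad f (alg_z r f x_init L_init M0 \<alpha> \<beta> (Suc K)))"
begin

definition x0 :: "nat \<Rightarrow> real ^ 'd" where
  "x0 K = start (alg_run r f x_init L_init M0 \<alpha> \<beta> K)"

definition L :: "nat \<Rightarrow> real" where
  "L K = stepL (alg_run r f x_init L_init M0 \<alpha> \<beta> K)"

definition k :: "nat \<Rightarrow> nat" where
  "k K = counter (alg_run r f x_init L_init M0 \<alpha> \<beta> K)"

abbreviation "X K \<equiv> epoch_x f (x0 K) (L K)"

abbreviation "S K \<equiv> epoch_S f (x0 K) (L K)"

lemma init [simp]: "x0 0 = x_init" "L 0 = L_init" "k 0 = 0"
  by (simp_all add: x0_def L_def k_def)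

text \<open>Iteration K + 1 works at index \<open>Suc (k K)\<close>. The case
  \<open>unsuccessful\<close> is the restart of step 3, \<open>successful\<close> that of step 4;
  the last two cases carry the decrease of f from passing step 3.\<close>

lemma run_cases [case_names unsuccessful successful continue]:
  obtains
    "f (X K (Suc (k K))) > f (x0 K) - L K * S K (Suc (k K)) / (2 * (real (Suc (k K)) + 1))"
    "x0 (Suc K) = X K (k K)" "L (Suc K) = \<alpha> * L K" "k (Suc K) = 0"
  | "f (X K (Suc (k K))) \<le> f (x0 K) - L K * S K (Suc (k K)) / (2 * (real (Suc (k K)) + 1))"
    "x0 (Suc K) = X K (Suc (k K))" "L (Suc K) = \<beta> * L K" "k (Suc K) = 0"
  | "f (X K (Suc (k K))) \<le> f (x0 K) - L K * S K (Suc (k K)) / (2 * (real (Suc (k K)) + 1))"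
    "(real (Suc (k K)) + 1) ^ 5 * (epoch_M r f M0 (x0 K) (L K) (Suc (k K)))\<^sup>2 * S K (Suc (k K))
      \<le> (L K)\<^sup>2"
    "x0 (Suc K) = x0 K" "L (Suc K) = L K" "k (Suc K) = Suc (k K)"
proof -
  let ?s = "alg_run r f x_init L_init M0 \<alpha> \<beta> K"
  have step: "alg_run r f x_init L_init M0 \<alpha> \<beta> (Suc K) =
     (if f (X K (Suc (k K))) > f (x0 K) - L K * S K (Suc (k K)) / (2 * (real (Suc (k K)) + 1))
      then \<lparr>start = X K (k K), stepL = \<alpha> * L K, counter = 0\<rparr>
      else if (real (Suc (k K)) + 1) ^ 5 * (epoch_M r f M0 (x0 K) (L K) (Suc (k K)))\<^sup>2
          * S K (Suc (k K)) > (L K)\<^sup>2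
      then \<lparr>start = X K (Suc (k K)), stepL = \<beta> * L K, counter = 0\<rparr>
      else \<lparr>start = x0 K, stepL = L K, counter = Suc (k K)\<rparr>)"
    unfolding alg_run.simps alg_step_def Let_def x0_def[symmetric] L_def[symmetric] k_def[symmetric]
      add_0_right add_Suc_right One_nat_def diff_Suc_Suc diff_zero ..
  show ?thesis
  proof (cases "f (X K (Suc (k K))) > f (x0 K) - L K * S K (Suc (k K)) / (2 * (real (Suc (k K)) + 1))")
    case True
    show ?thesis
      by (rule that(1)[OF True])
        (simp_all only: x0_def[of "Suc K"] L_def[of "Suc K"] k_def[of "Suc K"]
          step True if_True alg_state.select_convs)
  next
    case descent: False
    show ?thesis
    proof (cases "(real (Suc (k K)) + 1) ^ 5 * (epoch_M r f M0 (x0 K) (L K) (Suc (k K)))\<^sup>2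
        * S K (Suc (k K)) > (L K)\<^sup>2")
      case True
      show ?thesis
        by (rule that(2)[OF leI[OF descent]])
          (simp_all only: x0_def[of "Suc K"] L_def[of "Suc K"] k_def[of "Suc K"]
            step descent True if_True if_False alg_state.select_convs)
    next
      case False
      show ?thesis
        by (rule that(3)[OF leI[OF descent] leI[OF False]])
          (simp_all only: x0_def[of "Suc K"] L_def[of "Suc K"] k_def[of "Suc K"]
            step descent False if_False alg_state.select_convs)
    qed
  qed
qed

lemma eps_le_averaged:
  "\<epsilon> \<le> norm (grad f (averaged_y f (x0 K) (L K) (Suc (k K))))"
  using eps_le[of K] by (simp add: alg_z_def Let_def x0_def L_def k_def)

lemma L_pos: "L K > 0"
proof (induction K)
  case (Suc K)
  then show ?case
    using alpha_gt_1 beta_pos by (cases rule: run_cases[of K]) auto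
qed (simp add: L_init_pos)

text \<open>The first iteration of an epoch averages only y_0 = x_0.\<close>

lemma eps_le_start: "\<epsilon> \<le> norm (grad f (x0 K))"
proof (induction K)
  case 0
  then show ?case
    using eps_le_averaged[of 0] by simp
next
  case (Suc K)
  then show ?case
    using eps_le_averaged[of "Suc K"] by (cases rule: run_cases[of K]) auto
qed

text \<open>For a step 3 restart, which falls back to this point: it is x_0 itself or passed step 3
  one iteration earlier.\<close>

lemma f_X_le: "f (X K (k K)) \<le> f (x0 K)"
proof (cases K)
  case (Suc K')
  have "0 \<le> L K' * S K' (Suc (k K')) / (2 * (real (Suc (k K')) + 1))"
    using L_pos[of K'] by (simp add: epoch_S_nonneg)
  then show ?thesis
    unfolding Suc by (cases rule: run_cases[of K']) auto
qed simp

text \<open>A nonzero counter comes from an iteration without restart, so step 4 was passed at this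
  very index.\<close>

lemma running:
  assumes "k K \<noteq> 0"
  shows "(real (k K) + 1) ^ 5 * M0\<^sup>2 * S K (k K) \<le> (L K)\<^sup>2"
    and "\<epsilon> \<le> norm (grad f (averaged_y f (x0 K) (L K) (k K)))"
proof -
  obtain K' where K: "K = Suc K'"
    using assms by (cases K) auto
  have M: "M0\<^sup>2 \<le> (epoch_M r f M0 (x0 K') (L K') (Suc (k K')))\<^sup>2"
    using M0_pos by (intro power_mono epoch_M_ge less_imp_le)
  have *: "(real (Suc (k K')) + 1) ^ 5 * M0\<^sup>2 * S K' (Suc (k K'))
    \<le> (real (Suc (k K')) + 1) ^ 5 * (epoch_M r f M0 (x0 K') (L K') (Suc (k K')))\<^sup>2 * S K' (Suc (k K'))"
    using M by (intro mult_right_mono mult_left_mono) (auto simp: epoch_S_nonneg)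
  show "(real (k K) + 1) ^ 5 * M0\<^sup>2 * S K (k K) \<le> (L K)\<^sup>2"
  proof (cases rule: run_cases[of K'])
    case continue
    show ?thesis
      unfolding K continue(3-5) using * continue(2) by (rule order_trans)
  qed (use assms K in auto)
  show "\<epsilon> \<le> norm (grad f (averaged_y f (x0 K) (L K) (k K)))"
    using assms eps_le_averaged[of K'] unfolding K by (cases rule: run_cases[of K']) auto
qed

section \<open>Bounds on the counter and on L\<close>

definition B :: "real \<Rightarrow> real" where
  "B c = ((2 * c\<^sup>2 + 2 * Lf * c) / (\<epsilon> * M0))\<^sup>2"

text \<open>Since \<open>M\<^sub>k \<ge> M\<^sub>0\<close>, surviving the test of step 4 forces
  \<open>S\<^sub>k = O(L\<^sup>2 / k\<^sup>5)\<close>, so the averaged gradient is at most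
  \<open>O(L\<^sup>2 k\<^bsup>-7/2\<^esup> + L k\<^bsup>-3/2\<^esup>)\<close>.
  Being bounded below by \<open>\<epsilon>\<close>, it leaves only bounded \<open>k\<close>, even if \<open>L\<close> may grow
  linearly in \<open>k\<close>.\<close>

lemma counter_bound:
  assumes "k K \<noteq> 0" and L_le: "L K \<le> c * (real (k K) + 1)"
  shows "real (k K) + 1 \<le> B c"
proof -
  define n where "n = real (k K) + 1"
  define s where "s = sqrt (S K (k K))"
  have n: "n \<ge> 1" "n > 0"
    by (simp_all add: n_def)
  have s: "0 \<le> s" "s\<^sup>2 = S K (k K)"
    by (simp_all add: s_def epoch_S_nonneg)
  have Lp: "L K > 0"
    by (rule L_pos)
  have Lc: "L K \<le> c * n"
    using L_le by (simp add: n_def)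
  have "0 < c * n"
    using Lp Lc by linarith
  then have c_pos: "c > 0"
    using n(2) by (simp add: zero_less_mult_iff)
  have "(n\<^sup>2 * sqrt n * M0 * s)\<^sup>2 = n ^ 5 * M0\<^sup>2 * S K (k K)"
    unfolding power_mult_distrib s(2) real_sqrt_pow2[OF less_imp_le[OF n(2)]]
    by (simp add: eval_nat_numeral)
  also have "\<dots> \<le> (L K)\<^sup>2"
    using running(1)[OF assms(1)] by (simp add: n_def)
  finally have sL: "n\<^sup>2 * sqrt n * M0 * s \<le> L K"
    using less_imp_le[OF Lp] by (rule power2_le_imp_le)
  have "\<epsilon> \<le> (2 * L K / n + 2 * Lf * (n - 1)) * s"
    using running(2)[OF assms(1)] norm_grad_averaged_le[OF Lp, of "k K" "x0 K"] assms(1)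
    by (simp add: n_def s_def)
  also have "\<dots> \<le> (2 * c * n + 2 * Lf * n) * s"
  proof (rule mult_right_mono)
    have "2 * L K / n \<le> 2 * c"
      using Lc n by (simp add: field_simps)
    also have "2 * c \<le> 2 * c * n"
      using n c_pos by simp
    finally have "2 * L K / n \<le> 2 * c * n" .
    moreover have "2 * Lf * (n - 1) \<le> 2 * Lf * n"
      using Lf_pos by simp
    ultimately show "2 * L K / n + 2 * Lf * (n - 1) \<le> 2 * c * n + 2 * Lf * n"
      by linarith
  qed (rule s)
  \<comment> \<open>Multiplying by n^(5/2) M0 trades s for L <= c n; then n^2 cancels and sqrt n
    remains.\<close>
  finally have "\<epsilon> * (n\<^sup>2 * sqrt n * M0) \<le> (2 * c + 2 * Lf) * n * s * (n\<^sup>2 * sqrt n * M0)"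
    using n M0_pos by (intro mult_right_mono) (auto simp: algebra_simps)
  also have "\<dots> = (2 * c + 2 * Lf) * n * (n\<^sup>2 * sqrt n * M0 * s)"
    by (simp add: algebra_simps)
  also have "\<dots> \<le> (2 * c + 2 * Lf) * n * (c * n)"
    using n c_pos Lf_pos sL Lc by (intro mult_left_mono) auto
  finally have "(\<epsilon> * M0 * sqrt n) * n\<^sup>2 \<le> (2 * c\<^sup>2 + 2 * Lf * c) * n\<^sup>2"
    by (simp add: algebra_simps power2_eq_square)
  then have "\<epsilon> * M0 * sqrt n \<le> 2 * c\<^sup>2 + 2 * Lf * c"
    using n by simp
  then have "sqrt n \<le> (2 * c\<^sup>2 + 2 * Lf * c) / (\<epsilon> * M0)"
    using eps_pos M0_pos by (simp add: field_simps)
  then have "(sqrt n)\<^sup>2 \<le> B c"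
    unfolding B_def using n by (intro power_mono) auto
  then show ?thesis
    using n by (simp add: n_def)
qed

lemma B_nonneg: "0 \<le> B c"
  by (simp add: B_def)

text \<open>If the condition of \<open>sufficient_descent\<close> fails at index k + 1, then L < 8
  Lf (k + 2) <= 16 Lf (k + 1). The summand 16 Lf excludes this for k = 0; for k >= 1,
  \<open>counter_bound\<close> with c = 16 Lf gives L < 16 Lf B(16 Lf), which the other summand
  excludes.\<close>

definition L_safe :: real where
  "L_safe = 16 * Lf * (1 + B (16 * Lf))"

lemma descent_if_L_large:
  assumes "L_safe \<le> L K"
  shows "f (X K (Suc (k K))) \<le> f (x0 K) - L K * S K (Suc (k K)) / (2 * (real (Suc (k K)) + 1))"
proof (rule sufficient_descent, rule ccontr)
  assume *: "\<not> 8 * Lf * (real (Suc (k K)) + 1) \<le> L K"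
  have "0 \<le> 16 * Lf * B (16 * Lf)"
    using Lf_pos B_nonneg by simp
  then have safe: "16 * Lf \<le> L K" "16 * Lf * B (16 * Lf) < L K"
    using assms Lf_pos by (simp_all add: L_safe_def algebra_simps)
  have k0: "k K \<noteq> 0"
  proof
    assume "k K = 0"
    with * safe(1) show False
      by simp
  qed
  have "0 \<le> Lf * real (k K)"
    using Lf_pos by simp
  then have lt: "L K < 16 * Lf * (real (k K) + 1)"
    using * by (simp add: algebra_simps)
  also have "\<dots> \<le> 16 * Lf * B (16 * Lf)"
    using counter_bound[OF k0 less_imp_le[OF lt]] Lf_pos by simp
  finally show False
    using safe by simp
qed

text \<open>Only step 3 raises L, by the factor \<alpha>, and never once L >=
  \<open>L_safe\<close>.\<close>

definition L_max :: real where
  "L_max = max L_init (\<alpha> * L_safe)"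

lemma L_max_pos: "0 < L_max"
  using L_init_pos by (simp add: L_max_def)

lemma L_le_L_max: "L K \<le> L_max"
proof (induction K)
  case (Suc K)
  show ?case
  proof (cases rule: run_cases[of K])
    case unsuccessful
    then have "L K \<le> L_safe"
      using descent_if_L_large[of K] by linarith
    then have "\<alpha> * L K \<le> \<alpha> * L_safe"
      using alpha_gt_1 by simp
    then show ?thesis
      using unsuccessful by (simp add: L_max_def)
  next
    case successful
    have "\<beta> * L K \<le> L K"
      using L_pos[of K] beta_pos beta_le_1 by (simp add: mult_left_le_one_le)
    then show ?thesis
      using Suc successful by simp
  qed (use Suc in simp)
qed (simp add: L_max_def)

lemma counter_le: "real (k K) \<le> B L_max"
proof (cases "k K = 0")
  case False
  have "L_max * 1 \<le> L_max * (real (k K) + 1)"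
    using L_max_pos by (intro mult_left_mono) auto
  then show ?thesis
    using counter_bound[OF False, of L_max] L_le_L_max[of K] by simp
qed (simp add: B_nonneg)

text \<open>The decrease L S / (2 (k + 2)) is at least \<epsilon>^2 / (2 L (k + 2)) as S >=
  \<epsilon>^2 / L^2; then L and k are replaced by their bounds.\<close>

definition \<delta> :: real where
  "\<delta> = \<epsilon>\<^sup>2 / (2 * L_max * (B L_max + 2))"

lemma delta_pos: "0 < \<delta>"
  using eps_pos L_max_pos B_nonneg[of L_max] by (simp add: \<delta>_def)

lemma delta_le: "\<delta> \<le> L K * S K (Suc (k K)) / (2 * (real (Suc (k K)) + 1))"
proof -
  have Lp: "0 < L K"
    by (rule L_pos)
  have "\<delta> \<le> \<epsilon>\<^sup>2 / (2 * L K * (real (k K) + 2))"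
    unfolding \<delta>_def using Lp L_le_L_max[of K] counter_le[of K]
    by (intro divide_left_mono mult_mono mult_pos_pos) auto
  also have "\<dots> = L K * (\<epsilon>\<^sup>2 / (L K)\<^sup>2) / (2 * (real (k K) + 2))"
    using Lp by (simp add: power2_eq_square)
  also have "\<dots> \<le> L K * S K (Suc (k K)) / (2 * (real (k K) + 2))"
  proof (intro divide_right_mono mult_left_mono)
    have "\<epsilon>\<^sup>2 / (L K)\<^sup>2 \<le> (norm (grad f (x0 K)))\<^sup>2 / (L K)\<^sup>2"
      using eps_pos eps_le_start[of K] by (intro divide_right_mono power_mono) auto
    also have "\<dots> \<le> S K (Suc (k K))"
      using Lp by (intro epoch_S_ge) auto
    finally show "\<epsilon>\<^sup>2 / (L K)\<^sup>2 \<le> S K (Suc (k K))" .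
  qed (use Lp in auto)
  finally show ?thesis
    by (simp add: add.commute)
qed

text \<open>A bounded potential that grows by at least 1 in every iteration: a step 3 restart gains
  \<open>Q ln \<alpha>\<close>, a step 4 restart gains \<open>P \<delta> + Q ln \<beta>\<close>, and each
  of these exceeds the loss of the counter by 1.\<close>

lemma contradiction: False
proof -
  define b where "b = B L_max"
  \<comment> \<open>A reset costs at most b in the counter, and 1 must be gained. P is fixed after Q
    because step 4 must also repay Q ln \<beta> <= 0.\<close>
  define Q where "Q = (b + 1) / ln \<alpha>"
  define P where "P = (b + 1 - Q * ln \<beta>) / \<delta>"
  define \<Phi> where "\<Phi> K = Q * ln (L K) - P * f (x0 K) + real (k K)" for K
  have Q: "0 \<le> Q" "Q * ln \<alpha> = b + 1"
    using alpha_gt_1 B_nonneg[of L_max] by (simp_all add: Q_def b_def)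
  have "Q * ln \<beta> \<le> 0"
    using Q(1) beta_pos beta_le_1 by (simp add: mult_nonneg_nonpos)
  then have P: "0 \<le> P" "P * \<delta> = b + 1 - Q * ln \<beta>"
    using delta_pos B_nonneg[of L_max] by (simp_all add: P_def b_def)
  have k_le: "real (k K) \<le> b" for K
    using counter_le by (simp add: b_def)
  have step: "\<Phi> K + 1 \<le> \<Phi> (Suc K)" for K
  proof (cases rule: run_cases[of K])
    case unsuccessful
    have "P * f (x0 (Suc K)) \<le> P * f (x0 K)"
      using unsuccessful f_X_le P(1) by (simp add: mult_left_mono)
    moreover have "Q * ln (L (Suc K)) = Q * ln (L K) + (b + 1)"
      using unsuccessful L_pos[of K] alpha_gt_1 Q(2) by (simp add: ln_mult algebra_simps)
    ultimately show ?thesis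
      using k_le[of K] unsuccessful by (simp add: \<Phi>_def)
  next
    case successful
    have "P * f (x0 (Suc K)) \<le> P * (f (x0 K) - \<delta>)"
      using successful delta_le[of K] P(1) by (intro mult_left_mono) auto
    moreover have "Q * ln (L (Suc K)) = Q * ln (L K) + Q * ln \<beta>"
      using successful L_pos[of K] beta_pos by (simp add: ln_mult algebra_simps)
    ultimately show ?thesis
      using k_le[of K] successful P(2) by (simp add: \<Phi>_def algebra_simps)
  next
    case continue
    then show ?thesis
      by (simp add: \<Phi>_def)
  qed
  have growth: "\<Phi> 0 + real K \<le> \<Phi> K" for K
  proof (induction K)
    case (Suc K)
    then show ?case
      using step[of K] by simp
  qed simp
  obtain m where m: "m \<le> f x" for x
    using bdd by (auto simp: bdd_below_def)
  have bound: "\<Phi> K \<le> Q * ln L_max - P * m + b" for K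
  proof -
    have "Q * ln (L K) \<le> Q * ln L_max"
      using Q(1) L_pos L_le_L_max[of K] L_max_pos by (intro mult_left_mono) auto
    moreover have "P * m \<le> P * f (x0 K)"
      using P(1) m by (intro mult_left_mono) auto
    ultimately show ?thesis
      using k_le[of K] by (simp add: \<Phi>_def)
  qed
  obtain K where "Q * ln L_max - P * m + b - \<Phi> 0 < real K"
    using reals_Archimedean2 by blast
  then show False
    using growth[of K] bound[of K] by linarith
qed

end

theorem corollary5p8:
  fixes f :: "real ^ 'd \<Rightarrow> real" and x_init :: "real ^ 'd"
    and L_f M_f L_init M0 \<alpha> \<beta> :: real and r :: M_rule
  assumes "L_f > 0" and "M_f > 0"
    and "twice_differentiable f"
    and "bdd_below (range f)"
    and "\<And>x y. norm (grad f x - grad f y) \<le> L_f * norm (x - y)"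
    and "\<And>x y. onorm ((*v) (hessian f x - hessian f y)) \<le> M_f * norm (x - y)"
    and "L_init > 0" and "M0 > 0" and "\<alpha> > 1" and "0 < \<beta>" and "\<beta> \<le> 1"
  shows "(\<lambda>K. Min ((\<lambda>i. norm (grad f (alg_z r f x_init L_init M0 \<alpha> \<beta> i))) ` {1..K}))
           \<longlonglongrightarrow> 0"
proof (rule LIMSEQ_I)
  fix e :: real
  assume "0 < e"
  let ?g = "\<lambda>i. norm (grad f (alg_z r f x_init L_init M0 \<alpha> \<beta> i))"
  \<comment> \<open>The minimum never increases with K, so one iterate below e suffices.\<close>
  obtain i where i: "?g (Suc i) < e"
  proof (rule ccontr)
    assume "\<not> thesis"
    then have "e \<le> ?g (Suc i)" for i
      using that by (meson not_less)
    then interpret run_with_large_gradients f L_f r x_init L_init M0 \<alpha> \<beta> e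
      using assms \<open>0 < e\<close> by unfold_locales (auto simp: twice_differentiable_def)
    show False
      by (rule contradiction)
  qed
  have "norm (Min (?g ` {1..K}) - 0) < e" if "Suc i \<le> K" for K
  proof -
    have "Min (?g ` {1..K}) \<le> ?g (Suc i)"
      using that by (intro Min_le) auto
    moreover have "0 \<le> Min (?g ` {1..K})"
      using that by (subst Min_ge_iff) auto
    ultimately show ?thesis
      using i by simp
  qed
  then show "\<exists>n0. \<forall>K\<ge>n0. norm (Min (?g ` {1..K}) - 0) < e"
    by blast
qed

end
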